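(* Let $\lambda$ be a partition whose Young diagram contains that of $(3,3,1)$ or that of $(2,2,2,2)$. Then there exist finite naturally labeled posets $P$ and $Q$ with $P\not\cong Q$, $\operatorname{sh}(P)=\operatorname{sh}(Q)=\lambda$, and $K_P(\mathbf{x})=K_Q(\mathbf{x})$.
   Context: A poset $(P,\preceq)$ on ground set $[n]=\{1,\dots,n\}$ is naturally labeled if $x\preceq y$ implies $x\le y$ as integers. For such $P$, the $P$-partition generating function is $K_P(\mathbf{x})=\sum_{\sigma}\prod_{p\in P}x_{\sigma(p)}$, the sum over all maps $\sigma:P\to\mathbb{Z}^+$ with $\sigma(x)\le\sigma(y)$ whenever $x\preceq y$. The shape $\operatorname{sh}(P)$ is the partition $\lambda$ whose conjugate $\lambda'$ satisfies $\lambda'_1+\cdots+\lambda'_i=a_i$ for all $i$, where $a_i$ is the maximum number of elements in a union of $i$ antichains of $P$. *)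

theory Defs
  imports Main "HOL-Library.FuncSet" "HOL-Library.Poly_Mapping"
begin

definition naturally_labeled_poset :: "nat \<Rightarrow> nat rel \<Rightarrow> bool" where
  "naturally_labeled_poset n r \<longleftrightarrow>
     partial_order_on {1..n} r \<and> (\<forall>x y. (x, y) \<in> r \<longrightarrow> x \<le> y)"

definition poset_isomorphic :: "'a set \<Rightarrow> 'a rel \<Rightarrow> 'b set \<Rightarrow> 'b rel \<Rightarrow> bool" where
  "poset_isomorphic A r B s \<longleftrightarrow>
     (\<exists>f. bij_betw f A B \<and> (\<forall>x\<in>A. \<forall>y\<in>A. (x, y) \<in> r \<longleftrightarrow> (f x, f y) \<in> s))"

text \<open>
  A formal power series in the variables $x_1, x_2, \ldots$ is represented by its coefficient
  function on monomials, and a monomial by its finitely supported exponent vector, so that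
  multiplication of monomials is addition of exponent vectors.
\<close>

type_synonym monomial = "nat \<Rightarrow>\<^sub>0 nat"

definition P_partitions :: "'a set \<Rightarrow> 'a rel \<Rightarrow> ('a \<Rightarrow> nat) set" where
  "P_partitions A r =
     {\<sigma> \<in> A \<rightarrow>\<^sub>E {1..}. \<forall>x y. (x, y) \<in> r \<longrightarrow> \<sigma> x \<le> \<sigma> y}"

definition P_partition_monomial :: "'a set \<Rightarrow> ('a \<Rightarrow> nat) \<Rightarrow> monomial" where
  "P_partition_monomial A \<sigma> = (\<Sum>p\<in>A. Poly_Mapping.single (\<sigma> p) 1)"

text \<open>
  The coefficient of a monomial \<open>m\<close> in $\sum_\sigma \prod_{p} x_{\sigma(p)}$ is the number of
  $\sigma$ contributing \<open>m\<close>.  For finite posets this number is finite, see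
  \<open>finite_P_partitions_with_monomial\<close>, so \<open>card\<close> has no degenerate values here.
\<close>

definition P_partition_gf :: "'a set \<Rightarrow> 'a rel \<Rightarrow> monomial \<Rightarrow> int" where
  "P_partition_gf A r =
     (\<lambda>m. int (card {\<sigma> \<in> P_partitions A r. P_partition_monomial A \<sigma> = m}))"

lemma finite_P_partitions_with_monomial:
  assumes "finite A"
  shows "finite {\<sigma> \<in> P_partitions A r. P_partition_monomial A \<sigma> = m}"
proof (rule finite_subset)
  show "{\<sigma> \<in> P_partitions A r. P_partition_monomial A \<sigma> = m} \<subseteq> A \<rightarrow>\<^sub>E Poly_Mapping.keys m"
  proof
    fix \<sigma> assume s: "\<sigma> \<in> {\<sigma> \<in> P_partitions A r. P_partition_monomial A \<sigma> = m}"
    have "\<sigma> p \<in> Poly_Mapping.keys m" if p: "p \<in> A" for p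
    proof -
      let ?e = "\<lambda>q. Poly_Mapping.lookup (Poly_Mapping.single (\<sigma> q) (1::nat)) (\<sigma> p)"
      have "Poly_Mapping.lookup m (\<sigma> p) = (\<Sum>q\<in>A. ?e q)"
        using s by (auto simp: P_partition_monomial_def lookup_sum)
      also have "\<dots> \<ge> ?e p"
        by (rule member_le_sum) (use p assms in auto)
      finally show ?thesis by (simp add: in_keys_iff)
    qed
    with s show "\<sigma> \<in> A \<rightarrow>\<^sub>E Poly_Mapping.keys m" by (auto simp: P_partitions_def PiE_iff)
  qed
  show "finite (A \<rightarrow>\<^sub>E Poly_Mapping.keys m)" using assms by (intro finite_PiE) auto
qed

text \<open>A partition is the weakly decreasing list of its (positive) parts.\<close>

definition is_partition :: "nat list \<Rightarrow> bool" where
  "is_partition lam \<longleftrightarrow> sorted_wrt (\<ge>) lam \<and> 0 \<notin> set lam"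

text \<open>Rows and columns of the Young diagram are numbered from 0.\<close>

definition young_diagram :: "nat list \<Rightarrow> (nat \<times> nat) set" where
  "young_diagram lam = {(i, j). i < length lam \<and> j < lam ! i}"

text \<open>
  \<open>conjugate_part lam j\<close> is the \<open>j\<close>-th part of the conjugate partition for \<open>j \<ge> 1\<close>,
  continued by zeros once the actual parts are exhausted.
\<close>

definition conjugate_part :: "nat list \<Rightarrow> nat \<Rightarrow> nat" where
  "conjugate_part lam j = card {i. i < length lam \<and> j \<le> lam ! i}"

definition antichain_in :: "'a set \<Rightarrow> 'a rel \<Rightarrow> 'a set \<Rightarrow> bool" where
  "antichain_in A r C \<longleftrightarrow> C \<subseteq> A \<and> (\<forall>x\<in>C. \<forall>y\<in>C. (x, y) \<in> r \<longrightarrow> x = y)"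

definition max_antichain_union :: "'a set \<Rightarrow> 'a rel \<Rightarrow> nat \<Rightarrow> nat" where
  "max_antichain_union A r i =
     Max {card (\<Union>k<i. C k) | C :: nat \<Rightarrow> 'a set. \<forall>k<i. antichain_in A r (C k)}"

text \<open>
  The shape exists for every finite poset by Greene's theorem.  It is unique
  (\<open>has_shape_unique\<close>), so \<open>has_shape A r lam\<close> says that \<open>lam\<close> is the shape; stating this as a
  relation avoids a definite description that presupposes existence.
\<close>

definition has_shape :: "'a set \<Rightarrow> 'a rel \<Rightarrow> nat list \<Rightarrow> bool" where
  "has_shape A r lam \<longleftrightarrow>
     is_partition lam \<and>
     (\<forall>i. (\<Sum>j = 1..i. conjugate_part lam j) = max_antichain_union A r i)"

lemma conjugate_part_gt_iff:
  assumes "is_partition lam" "j \<ge> 1"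
  shows "i < conjugate_part lam j \<longleftrightarrow> i < length lam \<and> j \<le> lam ! i"
proof -
  let ?S = "{i. i < length lam \<and> j \<le> lam ! i}"
  have down: "i \<in> ?S" if "k \<in> ?S" "i \<le> k" for i k
  proof (cases "i = k")
    case False
    then have "lam ! k \<le> lam ! i"
      using assms(1) that by (auto simp: is_partition_def sorted_wrt_iff_nth_less)
    then show ?thesis using that by auto
  qed (use that in simp)
  have fin: "finite ?S" by simp
  show ?thesis
  proof
    assume i: "i < conjugate_part lam j"
    show "i < length lam \<and> j \<le> lam ! i"
    proof (rule ccontr)
      assume n: "\<not> ?thesis"
      have "?S \<subseteq> {..<i}"
      proof
        fix k assume "k \<in> ?S"
        then show "k \<in> {..<i}" using down[of k i] n by (cases "i \<le> k") auto
      qed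
      then have "card ?S \<le> i" using card_mono[of "{..<i}" ?S] by simp
      then show False using i by (simp add: conjugate_part_def)
    qed
  next
    assume "i < length lam \<and> j \<le> lam ! i"
    then have "{..i} \<subseteq> ?S" using down[of i] by auto
    then have "card {..i} \<le> card ?S" using fin by (rule card_mono[rotated])
    then show "i < conjugate_part lam j" by (simp add: conjugate_part_def)
  qed
qed

lemma has_shape_unique:
  assumes "has_shape A r lam" "has_shape A r mu"
  shows "lam = mu"
proof -
  have part: "is_partition lam" "is_partition mu"
    using assms by (auto simp: has_shape_def)
  have eq: "(\<Sum>j = 1..i. conjugate_part lam j) = (\<Sum>j = 1..i. conjugate_part mu j)" for i
    using assms by (simp add: has_shape_def)
  have conj: "conjugate_part lam j = conjugate_part mu j" if "j \<ge> 1" for j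
  proof -
    have "j = Suc (j - 1)" using that by simp
    then obtain i where "j = Suc i" ..
    then show ?thesis using eq[of i] eq[of "Suc i"] by simp
  qed
  have iff: "i < length lam \<and> j \<le> lam ! i \<longleftrightarrow> i < length mu \<and> j \<le> mu ! i"
    if "j \<ge> 1" for i j
    using conjugate_part_gt_iff[OF part(1) that, of i]
      conjugate_part_gt_iff[OF part(2) that, of i] conj[OF that] by simp
  have pos: "i < length lam \<Longrightarrow> 1 \<le> lam ! i" "i < length mu \<Longrightarrow> 1 \<le> mu ! i" for i
    using part by (auto simp: is_partition_def Suc_le_eq dest: nth_mem intro!: gr0I)
  have len: "i < length lam \<longleftrightarrow> i < length mu" for i
    using iff[of 1 i] pos[of i] by auto
  have leneq: "length lam = length mu"
    using len[of "length lam"] len[of "length mu"] by simp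
  show ?thesis
  proof (rule nth_equalityI[OF leneq])
    fix i assume i: "i < length lam"
    then show "lam ! i = mu ! i"
      using iff[of "lam ! i" i] iff[of "mu ! i" i] pos[of i] len[of i] by (auto intro: antisym)
  qed
qed

end

theory Submission
  imports Defs "HOL-Combinatorics.Permutations" "HOL-Library.Infinite_Set"
begin

text \<open>
  It suffices to find pairs of posets for the shapes (3,3,1), (3,3,2), (3,3,3) and (2,2,2,2):
  disjoint unions with chains add rows to the shape, ordinal sums with antichains add columns, and
  neither destroys equality of the generating functions.  For each core pair \<open>P\<close>, \<open>Q\<close> the
  generating functions agree because the \<open>P\<close>-partitions can be split according to one inequality
  $\sigma(u) \le \sigma(v)$ between incomparable elements, and the \<open>Q\<close>-partitions according to
  another one, such that the corresponding halves are matched by permuting the elements.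
  Non-isomorphism survives the extension because \<open>P\<close> and \<open>Q\<close> are told apart by an induced
  five-element poset that is connected as a comparability and as an incomparability graph and
  hence must lie inside the core.
\<close>

section \<open>Shapes from chain and antichain decompositions\<close>

text \<open>Both sides count the cells in the first \<open>i\<close> columns of the diagram, once by
  columns and once by rows.\<close>

lemma sum_conjugate_part:
  "(\<Sum>j = 1..i. conjugate_part lam j) = (\<Sum>k<length lam. min i (lam ! k))"
proof -
  have "conjugate_part lam j = (\<Sum>k<length lam. if j \<le> lam ! k then 1 else 0)" for j
    by (auto simp: conjugate_part_def sum.If_cases intro: arg_cong[of _ _ card])
  then have "(\<Sum>j = 1..i. conjugate_part lam j)
      = (\<Sum>k<length lam. \<Sum>j = 1..i. if j \<le> lam ! k then 1 else 0)"
    by (simp only: sum.swap[of _ "{..<length lam}"])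
  also have "\<dots> = (\<Sum>k<length lam. min i (lam ! k))"
  proof (rule sum.cong)
    fix k
    have "{1..i} \<inter> {j. j \<le> lam ! k} = {1..min i (lam ! k)}" by auto
    then show "(\<Sum>j = 1..i. if j \<le> lam ! k then 1 else 0) = min i (lam ! k)"
      by (simp add: sum.If_cases)
  qed simp
  finally show ?thesis .
qed

lemma finite_young_diagram: "finite (young_diagram lam)"
proof -
  have "young_diagram lam = Sigma {..<length lam} (\<lambda>i. {..<lam ! i})"
    by (auto simp: young_diagram_def)
  then show ?thesis by simp
qed

text \<open>Each row is a chain and meets an antichain at most once, so a union of \<open>i\<close>
  antichains has at most \<open>min i (lam ! k)\<close> elements in row \<open>k\<close>. The first
  \<open>i\<close> columns attain all these bounds together.\<close>

lemma has_shape_if_young_bij: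
  assumes lam: "is_partition lam" and g: "bij_betw g A (young_diagram lam)"
    and row: "\<And>x y. \<lbrakk>x \<in> A; y \<in> A; fst (g x) = fst (g y)\<rbrakk> \<Longrightarrow> (x, y) \<in> r \<or> (y, x) \<in> r"
    and col: "\<And>x y. \<lbrakk>x \<in> A; y \<in> A; snd (g x) = snd (g y); (x, y) \<in> r\<rbrakk> \<Longrightarrow> x = y"
  shows "has_shape A r lam"
proof -
  have fin: "finite A"
    using g finite_young_diagram bij_betw_finite by blast
  have gin: "g x \<in> young_diagram lam" if "x \<in> A" for x
    using g that by (auto simp: bij_betw_def)
  define row_of where "row_of k = {x \<in> A. fst (g x) = k}" for k
  have Max: "max_antichain_union A r i = (\<Sum>k<length lam. min i (lam ! k))" for i
    unfolding max_antichain_union_def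
  proof (rule Max_eqI)
    have "card (\<Union>k<i. C k) \<le> card A" if "\<forall>k<i. antichain_in A r (C k)" for C
      using that fin by (intro card_mono) (auto simp: antichain_in_def)
    then show "finite {card (\<Union>k<i. C k) | C. \<forall>k<i. antichain_in A r (C k)}"
      by (intro finite_subset[OF _ finite_atMost[of "card A"]]) auto
  next
    fix y assume "y \<in> {card (\<Union>k<i. C k) | C. \<forall>k<i. antichain_in A r (C k)}"
    then obtain C where y: "y = card (\<Union>k<i. C k)" and C: "\<And>k. k < i \<Longrightarrow> antichain_in A r (C k)"
      by auto
    let ?U = "\<Union>k<i. C k"
    have UA: "?U \<subseteq> A" using C by (fastforce simp: antichain_in_def)
    have fU: "finite ?U" using UA fin by (rule finite_subset)
    have "?U = (\<Union>k<length lam. ?U \<inter> row_of k)"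
      using UA gin by (force simp: row_of_def young_diagram_def)
    then have "y \<le> (\<Sum>k<length lam. card (?U \<inter> row_of k))"
      unfolding y by (metis card_UN_le finite_lessThan)
    also have "\<dots> \<le> (\<Sum>k<length lam. min i (lam ! k))"
    proof (rule sum_mono)
      fix k assume "k \<in> {..<length lam}"
      have "card (?U \<inter> row_of k) = card (\<Union>m<i. C m \<inter> row_of k)"
        by (rule arg_cong[of _ _ card]) auto
      also have "\<dots> \<le> (\<Sum>m<i. card (C m \<inter> row_of k))"
        by (rule card_UN_le) simp
      also have "\<dots> \<le> (\<Sum>m<i. 1)"
      proof (rule sum_mono)
        fix m assume "m \<in> {..<i}"
        then have "antichain_in A r (C m)" using C by simp
        then have "x = y" if "x \<in> C m \<inter> row_of k" "y \<in> C m \<inter> row_of k" for x y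
          using that row[of x y] by (auto simp: antichain_in_def row_of_def)
        then show "card (C m \<inter> row_of k) \<le> 1"
          by (intro card_le_Suc0_iff_eq[THEN iffD2, simplified One_nat_def[symmetric]])
             (auto intro: finite_subset[OF _ fin] simp: row_of_def)
      qed
      finally have 1: "card (?U \<inter> row_of k) \<le> i" by simp
      have "inj_on (snd \<circ> g) (?U \<inter> row_of k)"
        using g by (auto simp: inj_on_def bij_betw_def row_of_def prod_eq_iff)
      moreover have "(snd \<circ> g) ` (?U \<inter> row_of k) \<subseteq> {..<lam ! k}"
        using gin by (force simp: row_of_def young_diagram_def)
      ultimately have "card (?U \<inter> row_of k) \<le> lam ! k"
        using card_inj_on_le[of "snd \<circ> g" "?U \<inter> row_of k" "{..<lam ! k}"] by simp
      with 1 show "card (?U \<inter> row_of k) \<le> min i (lam ! k)" by simp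
    qed
    finally show "y \<le> (\<Sum>k<length lam. min i (lam ! k))" .
  next
    let ?C = "\<lambda>k. {x \<in> A. snd (g x) = k}"
    have "g ` (\<Union>k<i. ?C k) = Sigma {..<length lam} (\<lambda>k. {..<min i (lam ! k)})"
    proof (intro equalityI subsetI)
      fix z assume "z \<in> Sigma {..<length lam} (\<lambda>k. {..<min i (lam ! k)})"
      then have z: "z \<in> young_diagram lam" "snd z < i" by (auto simp: young_diagram_def)
      then obtain x where "x \<in> A" "z = g x" using g by (auto simp: bij_betw_def)
      with z show "z \<in> g ` (\<Union>k<i. ?C k)" by auto
    qed (use gin in \<open>force simp: young_diagram_def\<close>)
    moreover have "inj_on g (\<Union>k<i. ?C k)"
      using g by (auto simp: bij_betw_def inj_on_def)
    ultimately have "card (\<Union>k<i. ?C k) = (\<Sum>k<length lam. min i (lam ! k))"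
      using card_image[of g "\<Union>k<i. ?C k"] by simp
    moreover have "\<forall>k<i. antichain_in A r (?C k)"
      using col by (auto simp: antichain_in_def)
    ultimately show "(\<Sum>k<length lam. min i (lam ! k))
        \<in> {card (\<Union>k<i. C k) | C. \<forall>k<i. antichain_in A r (C k)}"
      by (intro CollectI exI[of _ ?C]) simp
  qed
  show ?thesis
    unfolding has_shape_def Max sum_conjugate_part using lam by simp
qed

section \<open>Isomorphisms and natural labelings\<close>

lemma poset_isomorphic_sym:
  assumes "poset_isomorphic A r B s"
  shows "poset_isomorphic B s A r"
proof -
  obtain f where f: "bij_betw f A B" "\<forall>x\<in>A. \<forall>y\<in>A. (x, y) \<in> r \<longleftrightarrow> (f x, f y) \<in> s"
    using assms by (auto simp: poset_isomorphic_def)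
  have "bij_betw (inv_into A f) B A" using f(1) by (rule bij_betw_inv_into)
  moreover have "f (inv_into A f x) = x" "inv_into A f x \<in> A" if "x \<in> B" for x
    using f(1) that by (auto simp: bij_betw_def f_inv_into_f inv_into_into)
  ultimately show ?thesis unfolding poset_isomorphic_def using f(2) by metis
qed

lemma poset_isomorphic_trans:
  assumes "poset_isomorphic A r B s" "poset_isomorphic B s C t"
  shows "poset_isomorphic A r C t"
proof -
  obtain f where f: "bij_betw f A B" "\<forall>x\<in>A. \<forall>y\<in>A. (x, y) \<in> r \<longleftrightarrow> (f x, f y) \<in> s"
    using assms by (auto simp: poset_isomorphic_def)
  obtain g where g: "bij_betw g B C" "\<forall>x\<in>B. \<forall>y\<in>B. (x, y) \<in> s \<longleftrightarrow> (g x, g y) \<in> t"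
    using assms by (auto simp: poset_isomorphic_def)
  have "bij_betw (g \<circ> f) A C" using f(1) g(1) by (rule bij_betw_trans)
  moreover have "f x \<in> B" if "x \<in> A" for x using f(1) that by (auto simp: bij_betw_def)
  ultimately show ?thesis unfolding poset_isomorphic_def using f(2) g(2) by force
qed

text \<open>Reindexing the maps along the isomorphism keeps the monomials. The inclusions matter
  because \<open>P_partitions\<close> tests all pairs of a relation, whereas an isomorphism controls
  only pairs inside the ground sets.\<close>

lemma P_partition_gf_isomorphic:
  assumes iso: "poset_isomorphic A r B s" and r: "r \<subseteq> A \<times> A" and s: "s \<subseteq> B \<times> B"
  shows "P_partition_gf A r = P_partition_gf B s"
proof -
  obtain f where f: "bij_betw f A B" and rs: "\<And>x y. x \<in> A \<Longrightarrow> y \<in> A \<Longrightarrow> (x, y) \<in> r \<longleftrightarrow> (f x, f y) \<in> s"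
    using iso by (auto simp: poset_isomorphic_def)
  let ?f' = "inv_into A f"
  have fB: "f x \<in> B" if "x \<in> A" for x using f that by (auto simp: bij_betw_def)
  have f': "?f' (f x) = x" if "x \<in> A" for x using f that by (simp add: bij_betw_def)
  have f'B: "f (?f' x) = x" "?f' x \<in> A" if "x \<in> B" for x
    using f that by (auto simp: bij_betw_def f_inv_into_f inv_into_into)
  have mon: "P_partition_monomial A (restrict (\<sigma> \<circ> f) A) = P_partition_monomial B \<sigma>" for \<sigma>
    unfolding P_partition_monomial_def
    using sum.reindex_bij_betw[OF f, of "\<lambda>x. Poly_Mapping.single (\<sigma> x) 1"]
    by (simp del: One_nat_def)
  have rs': "(x, y) \<in> s \<longleftrightarrow> (?f' x, ?f' y) \<in> r" if "x \<in> B" "y \<in> B" for x y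
    using rs[of "?f' x" "?f' y"] f'B that by simp
  have "bij_betw (\<lambda>\<sigma>. restrict (\<sigma> \<circ> f) A)
      {\<sigma> \<in> P_partitions B s. P_partition_monomial B \<sigma> = m}
      {\<sigma> \<in> P_partitions A r. P_partition_monomial A \<sigma> = m}" for m
  proof (rule bij_betw_byWitness[where f' = "\<lambda>\<sigma>. restrict (\<sigma> \<circ> ?f') B"])
    have restrict_back: "restrict (restrict (\<sigma> \<circ> ?f') B \<circ> f) A = \<sigma>" if "\<sigma> \<in> A \<rightarrow>\<^sub>E {1..}" for \<sigma> :: "'a \<Rightarrow> nat"
      using that fB f' by (auto simp: fun_eq_iff PiE_def extensional_def)
    then show "\<forall>\<sigma>\<in>{\<sigma> \<in> P_partitions A r. P_partition_monomial A \<sigma> = m}.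
        restrict (restrict (\<sigma> \<circ> ?f') B \<circ> f) A = \<sigma>"
      by (simp add: P_partitions_def)
    show "\<forall>\<sigma>\<in>{\<sigma> \<in> P_partitions B s. P_partition_monomial B \<sigma> = m}.
        restrict (restrict (\<sigma> \<circ> f) A \<circ> ?f') B = \<sigma>"
      using f'B by (auto simp: P_partitions_def fun_eq_iff PiE_def extensional_def)
    show "(\<lambda>\<sigma>. restrict (\<sigma> \<circ> f) A) ` {\<sigma> \<in> P_partitions B s. P_partition_monomial B \<sigma> = m}
        \<subseteq> {\<sigma> \<in> P_partitions A r. P_partition_monomial A \<sigma> = m}"
    proof safe
      fix \<sigma> assume "\<sigma> \<in> P_partitions B s"
      then show "restrict (\<sigma> \<circ> f) A \<in> P_partitions A r"
        using r rs fB by (auto simp: P_partitions_def)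
    qed (rule mon)
    show "(\<lambda>\<sigma>. restrict (\<sigma> \<circ> ?f') B) ` {\<sigma> \<in> P_partitions A r. P_partition_monomial A \<sigma> = m}
        \<subseteq> {\<sigma> \<in> P_partitions B s. P_partition_monomial B \<sigma> = m}"
    proof safe
      fix \<sigma> assume \<sigma>: "\<sigma> \<in> P_partitions A r"
      then show "restrict (\<sigma> \<circ> ?f') B \<in> P_partitions B s"
        using s rs' f'B by (auto simp: P_partitions_def)
      show "P_partition_monomial B (restrict (\<sigma> \<circ> ?f') B) = P_partition_monomial A \<sigma>"
        using mon[of "restrict (\<sigma> \<circ> ?f') B"] restrict_back[of \<sigma>] \<sigma> by (simp add: P_partitions_def)
    qed
  qed
  from bij_betw_same_card[OF this] show ?thesis
    by (simp add: P_partition_gf_def)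
qed

text \<open>Diagram coordinates then have to be given only for the poset of pairs, and not for its
  naturally labeled copy.\<close>

lemma has_shape_isomorphic_young_bij:
  assumes "poset_isomorphic B s A r"
    and lam: "is_partition lam" and g: "bij_betw g A (young_diagram lam)"
    and row: "\<And>x y. \<lbrakk>x \<in> A; y \<in> A; fst (g x) = fst (g y)\<rbrakk> \<Longrightarrow> (x, y) \<in> r \<or> (y, x) \<in> r"
    and col: "\<And>x y. \<lbrakk>x \<in> A; y \<in> A; snd (g x) = snd (g y); (x, y) \<in> r\<rbrakk> \<Longrightarrow> x = y"
  shows "has_shape B s lam"
proof -
  obtain f where f: "bij_betw f B A" and rs: "\<And>x y. x \<in> B \<Longrightarrow> y \<in> B \<Longrightarrow> (x, y) \<in> s \<longleftrightarrow> (f x, f y) \<in> r"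
    using assms(1) by (auto simp: poset_isomorphic_def)
  have fA: "f x \<in> A" if "x \<in> B" for x using f that by (auto simp: bij_betw_def)
  show ?thesis
  proof (rule has_shape_if_young_bij[OF lam bij_betw_trans[OF f g]])
    fix x y assume xy: "x \<in> B" "y \<in> B"
    show "(x, y) \<in> s \<or> (y, x) \<in> s" if "fst ((g \<circ> f) x) = fst ((g \<circ> f) y)"
      using row[of "f x" "f y"] that xy rs fA by simp
    show "x = y" if "snd ((g \<circ> f) x) = snd ((g \<circ> f) y)" "(x, y) \<in> s"
      using col[of "f x" "f y"] that xy rs fA f by (auto simp: bij_betw_def inj_on_def)
  qed
qed

text \<open>The labeling is a linear extension: elements are sorted by the size of their down-sets,
  which grows strictly along the order, and an arbitrary numbering breaks ties.\<close>

lemma ex_natural_labeling: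
  assumes fin: "finite A" and r: "partial_order_on A r"
  shows "\<exists>s. naturally_labeled_poset (card A) s \<and> poset_isomorphic A r {1..card A} s"
proof -
  have rA: "r \<subseteq> A \<times> A" and refl: "\<And>x. x \<in> A \<Longrightarrow> (x, x) \<in> r"
    and trans: "\<And>x y z. (x, y) \<in> r \<Longrightarrow> (y, z) \<in> r \<Longrightarrow> (x, z) \<in> r"
    and antisym: "\<And>x y. (x, y) \<in> r \<Longrightarrow> (y, x) \<in> r \<Longrightarrow> x = y"
    using r by (auto simp: partial_order_on_def preorder_on_def refl_on_def
        dest: transD antisymD)
  obtain g where g: "bij_betw g A {0..<card A}"
    using ex_bij_betw_finite_nat[OF fin] by blast
  have gless: "g x < card A" if "x \<in> A" for x using g that by (auto simp: bij_betw_def)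
  define down where "down x = {y. (y, x) \<in> r}" for x
  \<comment> \<open>The lexicographic order on down-set size and \<open>g x\<close>, packed into one
    number; \<open>g x < card A\<close> makes the packing faithful.\<close>
  define key where "key x = card (down x) * card A + g x" for x
  have "inj_on key A"
  proof (rule inj_onI)
    fix x y assume xy: "x \<in> A" "y \<in> A" "key x = key y"
    then have "key x mod card A = key y mod card A" by simp
    then have "g x = g y" using xy gless by (simp add: key_def)
    then show "x = y" using g xy by (auto simp: bij_betw_def inj_on_def)
  qed
  then have key: "bij_betw key A (key ` A)" by (simp add: bij_betw_def)
  have key_mono: "key x < key y" if "(x, y) \<in> r" "x \<noteq> y" for x y
  proof -
    have "down x \<subset> down y"
      using that trans antisym refl rA unfolding down_def by blast
    moreover have "finite (down y)"
      by (rule finite_subset[OF _ fin]) (use rA in \<open>auto simp: down_def\<close>)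
    ultimately have "Suc (card (down x)) \<le> card (down y)"
      by (simp add: psubset_card_mono Suc_leI)
    then have "Suc (card (down x)) * card A \<le> card (down y) * card A"
      by (rule mult_le_mono1)
    moreover have "g x < card A" using that rA gless by auto
    ultimately show ?thesis by (simp add: key_def)
  qed
  \<comment> \<open>\<open>h\<close> lists the keys increasingly, so its inverse yields ranks from
    0; the \<open>Suc\<close> in \<open>f\<close> shifts them to labels from 1.\<close>
  obtain h where h: "bij_betw h {..<card (key ` A)} (key ` A)"
    and hmono: "strict_mono_on {..<card (key ` A)} h"
    using ex_bij_betw_strict_mono_card[of "key ` A"] fin by auto
  have cardkey: "card (key ` A) = card A"
    using key bij_betw_same_card by metis
  let ?h' = "inv_into {..<card A} h"
  have h': "bij_betw ?h' (key ` A) {..<card A}"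
    using bij_betw_inv_into[OF h] cardkey by simp
  have h'key: "bij_betw (?h' \<circ> key) A {..<card A}"
    using key h' by (rule bij_betw_trans)
  have "bij_betw Suc {..<card A} {1..card A}"
    by (auto simp: bij_betw_def lessThan_atLeast0 image_Suc_atLeastLessThan)
  define f where "f = Suc \<circ> (?h' \<circ> key)"
  have f: "bij_betw f A {1..card A}"
    unfolding f_def using h'key \<open>bij_betw Suc _ _\<close> by (rule bij_betw_trans)
  have fmono: "f x \<le> f y" if "(x, y) \<in> r" for x y
  proof (cases "x = y")
    case False
    have xy: "x \<in> A" "y \<in> A" using that rA by auto
    have hf: "h (?h' (key z)) = key z" "?h' (key z) \<in> {..<card A}" if "z \<in> A" for z
      using h h'key that cardkey by (auto simp: bij_betw_def f_inv_into_f)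
    show ?thesis
    proof (rule ccontr)
      assume "\<not> f x \<le> f y"
      then have "?h' (key y) < ?h' (key x)" by (simp add: f_def)
      then have "h (?h' (key y)) < h (?h' (key x))"
        using hmono hf(2) xy cardkey by (auto simp: strict_mono_on_def)
      then show False using hf xy key_mono[OF that False] by simp
    qed
  qed simp
  define s where "s = map_prod f f ` r"
  have finj: "f x = f y \<longleftrightarrow> x = y" if "x \<in> A" "y \<in> A" for x y
    using f that by (auto simp: bij_betw_def inj_on_def)
  have sr: "(f x, f y) \<in> s \<longleftrightarrow> (x, y) \<in> r" if "x \<in> A" "y \<in> A" for x y
  proof
    assume "(f x, f y) \<in> s"
    then obtain a b where ab: "(a, b) \<in> r" "f x = f a" "f y = f b" by (auto simp: s_def)
    then have "x = a" "y = b" using finj rA that by auto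
    then show "(x, y) \<in> r" using ab by simp
  qed (auto simp: s_def)
  have fsurj: "\<exists>x\<in>A. z = f x" if "z \<in> {1..card A}" for z
    using f that by (auto simp: bij_betw_def)
  have s_obtain: "\<exists>x y. a = f x \<and> b = f y \<and> (x, y) \<in> r" if "(a, b) \<in> s" for a b
    using that by (auto simp: s_def)
  have "partial_order_on {1..card A} s"
    unfolding partial_order_on_def preorder_on_def
  proof (intro conjI)
    have "f x \<in> {1..card A}" if "x \<in> A" for x using bij_betwE[OF f] that by blast
    then show "s \<subseteq> {1..card A} \<times> {1..card A}"
      using rA unfolding s_def by (blast elim: prod_fun_imageE)
    show "refl_on {1..card A} s"
      unfolding refl_on_def using fsurj sr refl by metis
    show "trans s"
    proof (rule transI)
      fix a b c assume "(a, b) \<in> s" "(b, c) \<in> s"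
      then obtain x y y' z where *: "a = f x" "b = f y" "(x, y) \<in> r" "b = f y'" "c = f z" "(y', z) \<in> r"
        using s_obtain by metis
      then have "y = y'" using finj rA by auto
      then show "(a, c) \<in> s" using * trans[of x y z] by (auto simp: s_def)
    qed
    show "antisym s"
    proof (rule antisymI)
      fix a b assume "(a, b) \<in> s" "(b, a) \<in> s"
      then obtain x y where *: "a = f x" "b = f y" "(x, y) \<in> r" "(f y, f x) \<in> s"
        using s_obtain by metis
      then have "(y, x) \<in> r" using sr rA by auto
      then show "a = b" using * antisym by auto
    qed
  qed
  moreover have "\<forall>a b. (a, b) \<in> s \<longrightarrow> a \<le> b" using s_obtain fmono by blast
  ultimately have "naturally_labeled_poset (card A) s"
    by (simp add: naturally_labeled_poset_def)
  moreover have "poset_isomorphic A r {1..card A} s"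
    unfolding poset_isomorphic_def using f sr by blast
  ultimately show ?thesis by blast
qed

section \<open>Generating functions by piecewise permutation\<close>

text \<open>Precomposition with \<open>p\<close> only permutes the factors of a monomial, and it
  keeps functions extensional because \<open>p\<close> fixes everything outside
  \<open>A\<close>.\<close>

lemma card_P_partitions_permute:
  fixes F G :: "('a \<Rightarrow> nat) \<Rightarrow> bool"
  assumes p: "p permutes A" and FG: "\<And>\<sigma>. F (\<sigma> \<circ> p) \<longleftrightarrow> G \<sigma>"
  shows "card {\<sigma> \<in> A \<rightarrow>\<^sub>E {1..}. F \<sigma> \<and> P_partition_monomial A \<sigma> = m}
       = card {\<sigma> \<in> A \<rightarrow>\<^sub>E {1..}. G \<sigma> \<and> P_partition_monomial A \<sigma> = m}"
proof -
  have mon: "P_partition_monomial A (\<sigma> \<circ> p) = P_partition_monomial A \<sigma>" for \<sigma>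
    unfolding P_partition_monomial_def
    using sum.reindex_bij_betw[OF permutes_imp_bij[OF p], of "\<lambda>x. Poly_Mapping.single (\<sigma> x) 1"]
    by (simp del: One_nat_def)
  have comp_PiE: "\<sigma> \<circ> q \<in> A \<rightarrow>\<^sub>E {1..}" if "\<sigma> \<in> A \<rightarrow>\<^sub>E {1..}" "q permutes A" for q and \<sigma> :: "'a \<Rightarrow> nat"
    using that by (auto simp: PiE_iff extensional_def permutes_in_image permutes_not_in)
  note inv = permutes_inv[OF p] permutes_inv_o[OF p]
  have inv_comp: "\<sigma> \<circ> inv p \<circ> p = \<sigma>" "\<sigma> \<circ> p \<circ> inv p = \<sigma>" for \<sigma> :: "'a \<Rightarrow> nat"
    using inv by (auto simp: comp_assoc)
  have "bij_betw (\<lambda>\<sigma>. \<sigma> \<circ> p) {\<sigma> \<in> A \<rightarrow>\<^sub>E {1..}. G \<sigma> \<and> P_partition_monomial A \<sigma> = m}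
      {\<sigma> \<in> A \<rightarrow>\<^sub>E {1..}. F \<sigma> \<and> P_partition_monomial A \<sigma> = m}"
  proof (rule bij_betw_byWitness[where f' = "\<lambda>\<sigma>. \<sigma> \<circ> inv p"])
    show "(\<lambda>\<sigma>. \<sigma> \<circ> p) ` {\<sigma> \<in> A \<rightarrow>\<^sub>E {1..}. G \<sigma> \<and> P_partition_monomial A \<sigma> = m}
        \<subseteq> {\<sigma> \<in> A \<rightarrow>\<^sub>E {1..}. F \<sigma> \<and> P_partition_monomial A \<sigma> = m}"
      using comp_PiE[OF _ p] by (auto simp: FG mon simp del: comp_apply)
    show "(\<lambda>\<sigma>. \<sigma> \<circ> inv p) ` {\<sigma> \<in> A \<rightarrow>\<^sub>E {1..}. F \<sigma> \<and> P_partition_monomial A \<sigma> = m}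
        \<subseteq> {\<sigma> \<in> A \<rightarrow>\<^sub>E {1..}. G \<sigma> \<and> P_partition_monomial A \<sigma> = m}"
    proof (intro image_subsetI CollectI conjI)
      fix \<sigma> assume \<sigma>: "\<sigma> \<in> {\<sigma> \<in> A \<rightarrow>\<^sub>E {1..}. F \<sigma> \<and> P_partition_monomial A \<sigma> = m}"
      show "\<sigma> \<circ> inv p \<in> A \<rightarrow>\<^sub>E {1..}" using comp_PiE[OF _ inv(1)] \<sigma> by blast
      show "G (\<sigma> \<circ> inv p)" using FG[of "\<sigma> \<circ> inv p"] \<sigma> by (simp add: inv_comp)
      show "P_partition_monomial A (\<sigma> \<circ> inv p) = m"
        using mon[of "\<sigma> \<circ> inv p"] \<sigma> by (simp add: inv_comp)
    qed
  qed (simp_all add: inv_comp)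
  from bij_betw_same_card[OF this] show ?thesis by simp
qed

text \<open>The order condition alone, separated from the function space, so that it can be joined
  with an extra inequality and pulled back along a permutation.\<close>

definition rel_mono :: "'a rel \<Rightarrow> ('a \<Rightarrow> nat) \<Rightarrow> bool" where
  "rel_mono r \<sigma> \<longleftrightarrow> (\<forall>(x, y)\<in>r. \<sigma> x \<le> \<sigma> y)"

text \<open>Each side is cut in two by its own condition and the halves are matched separately. As
  \<open>p\<close> and \<open>q\<close> may differ, the orders need not be isomorphic.\<close>

lemma P_partition_gf_eqI:
  fixes r s :: "'a rel" and c d :: "('a \<Rightarrow> nat) \<Rightarrow> bool"
  assumes A: "finite A" and p: "p permutes A" and q: "q permutes A"
    and c: "\<And>\<sigma>. rel_mono r (\<sigma> \<circ> p) \<and> c (\<sigma> \<circ> p) \<longleftrightarrow> rel_mono s \<sigma> \<and> d \<sigma>"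
    and nc: "\<And>\<sigma>. rel_mono r (\<sigma> \<circ> q) \<and> \<not> c (\<sigma> \<circ> q) \<longleftrightarrow> rel_mono s \<sigma> \<and> \<not> d \<sigma>"
  shows "P_partition_gf A r = P_partition_gf A s"
proof
  fix m
  have split: "card {\<sigma> \<in> P_partitions A r. P_partition_monomial A \<sigma> = m}
    = card {\<sigma> \<in> A \<rightarrow>\<^sub>E {1..}. (rel_mono r \<sigma> \<and> c \<sigma>) \<and> P_partition_monomial A \<sigma> = m}
    + card {\<sigma> \<in> A \<rightarrow>\<^sub>E {1..}. (rel_mono r \<sigma> \<and> \<not> c \<sigma>) \<and> P_partition_monomial A \<sigma> = m}"
    (is "card ?S = card ?C + card ?N") for r :: "'a rel" and c
  proof -
    have S: "?S = ?C \<union> ?N" by (auto simp: P_partitions_def rel_mono_def)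
    have "finite (?C \<union> ?N)"
      unfolding S[symmetric] by (rule finite_P_partitions_with_monomial[OF A])
    moreover have "?C \<inter> ?N = {}" by auto
    ultimately show ?thesis
      unfolding S by (intro card_Un_disjoint) simp_all
  qed
  show "P_partition_gf A r m = P_partition_gf A s m"
    using split[of r c] split[of s d]
      card_P_partitions_permute[OF p, of "\<lambda>\<sigma>. rel_mono r \<sigma> \<and> c \<sigma>", OF c, of m]
      card_P_partitions_permute[OF q, of "\<lambda>\<sigma>. rel_mono r \<sigma> \<and> \<not> c \<sigma>", OF nc, of m]
    unfolding P_partition_gf_def by argo
qed

section \<open>Extending a layered core by antichains and chains\<close>

text \<open>
  Elements are pairs (row, level).  The core occupies rows below \<open>R\<close> and levels below \<open>c\<close>; the
  levels from \<open>c\<close> on are antichains stacked above it in the first \<open>R\<close> rows, and every further row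
  is a chain unrelated to everything else.  This realises the operations of taking ordinal sums
  with antichains and disjoint unions with chains, which add columns and rows to the shape.
\<close>

definition extend_core ::
    "nat \<Rightarrow> nat \<Rightarrow> (nat \<times> nat) rel \<Rightarrow> (nat \<times> nat) rel" where
  "extend_core R c E = {(x, y). x = y \<or>
     (if fst x < R \<and> fst y < R
      then if snd y < c then (x, y) \<in> E else snd x < snd y
      else fst x = fst y \<and> snd x < snd y)}"

text \<open>\<open>E\<close> is the strict part of the core order. The second condition makes levels
  antichains and the third makes rows chains, as \<open>has_shape_if_young_bij\<close> asks.\<close>

definition layered_core :: "nat \<Rightarrow> nat \<Rightarrow> (nat \<times> nat) rel \<Rightarrow> bool" where
  "layered_core R c E \<longleftrightarrow> trans E \<and>
     (\<forall>(x, y)\<in>E. fst x < R \<and> fst y < R \<and> snd x < snd y \<and> snd y < c) \<and>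
     (\<forall>i l l'. i < R \<longrightarrow> l < l' \<longrightarrow> l' < c \<longrightarrow> ((i, l), (i, l')) \<in> E)"

lemma layered_coreD:
  assumes "layered_core R c E"
  shows "trans E"
    and "(x, y) \<in> E \<Longrightarrow> fst x < R \<and> fst y < R \<and> snd x < snd y \<and> snd y < c"
    and "i < R \<Longrightarrow> l < l' \<Longrightarrow> l' < c \<Longrightarrow> ((i, l), (i, l')) \<in> E"
  using assms by (auto simp: layered_core_def)

text \<open>Gives antisymmetry, and makes every level an antichain that can serve as a column of the
  diagram.\<close>

lemma extend_core_level:
  assumes "layered_core R c E" "(x, y) \<in> extend_core R c E" "x \<noteq> y"
  shows "snd x < snd y"
  using assms(2,3) layered_coreD(2)[OF assms(1)] by (auto simp: extend_core_def split: if_splits)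

text \<open>Two proper steps inside the first \<open>R\<close> rows both lie in \<open>E\<close> if
  the last element has level below \<open>c\<close>; otherwise the level alone decides. The further
  rows are isolated chains.\<close>

lemma trans_extend_core:
  assumes E: "layered_core R c E"
  shows "trans (extend_core R c E)"
proof (rule transI)
  fix x y z assume xy: "(x, y) \<in> extend_core R c E" and yz: "(y, z) \<in> extend_core R c E"
  show "(x, z) \<in> extend_core R c E"
  proof (cases "x = y \<or> y = z")
    case False
    have "(x, z) \<in> E" if "(x, y) \<in> E" "(y, z) \<in> E"
      using layered_coreD(1)[OF E] that by (rule transD)
    then show ?thesis
      using xy yz False extend_core_level[OF E xy] extend_core_level[OF E yz]
      by (auto simp: extend_core_def split: if_splits)
  qed (use xy yz in auto)
qed

lemma partial_order_extend_core:
  assumes E: "layered_core R c E"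
  shows "partial_order_on A (extend_core R c E \<inter> A \<times> A)"
proof -
  note trans_extend_core[OF E]
  moreover have "antisym (extend_core R c E)"
    using extend_core_level[OF E] by (metis antisymI less_asym)
  moreover have "refl_on A (extend_core R c E \<inter> A \<times> A)"
    by (auto simp: refl_on_def extend_core_def)
  ultimately show ?thesis
    unfolding partial_order_on_def preorder_on_def
    by (auto intro!: transI antisymI dest: transD antisymD)
qed

lemma extend_core_row:
  assumes E: "layered_core R c E" and "fst x = fst y"
  shows "(x, y) \<in> extend_core R c E \<or> (y, x) \<in> extend_core R c E"
proof -
  have *: "(x, y) \<in> extend_core R c E" if "fst x = fst y" "snd x \<le> snd y" for x y
    using layered_coreD(3)[OF E, of "fst x" "snd x" "snd y"] that
    by (cases x; cases y; cases "snd x = snd y") (auto simp: extend_core_def)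
  show ?thesis using *[of x y] *[of y x] assms(2) by fastforce
qed

text \<open>The four elements form an induced zigzag, which is connected both as a comparability and as
  an incomparability graph, so that it cannot leave the core.\<close>

lemma zigzag_in_core:
  assumes E: "layered_core R c E" and le_def: "le = (\<lambda>x y. (x, y) \<in> extend_core R c E)"
    and le: "le d w" "le a w" "le a x"
    and inc: "\<not> le d a" "\<not> le a d" "\<not> le d x" "\<not> le x d" "\<not> le w x" "\<not> le x w"
  shows "{d, w, a, x} \<subseteq> {..<R} \<times> {..<c}"
proof -
  have same_row: "fst x = fst y" if "le x y" "R \<le> fst x \<or> R \<le> fst y" for x y
    using that by (auto simp: le_def extend_core_def split: if_splits)
  \<comment> \<open>Comparability never leaves a chain row, so one element there would drag the
    whole zigzag into that row and make \<open>d\<close> and \<open>a\<close> comparable.\<close>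
  have "\<not> R \<le> fst v" if "v \<in> {d, w, a, x}" for v
  proof
    assume "R \<le> fst v"
    then have "fst d = fst w" "fst a = fst w"
      using that le same_row[OF le(1)] same_row[OF le(2)] same_row[OF le(3)] by auto
    then show False using extend_core_row[OF E, of d a] inc by (auto simp: le_def)
  qed
  then have rows: "fst d < R" "fst w < R" "fst a < R" "fst x < R"
    by (simp_all add: not_le)
  have high: "le u v" if "fst u < R" "fst v < R" "c \<le> snd v" "snd u < snd v" for u v
    using that by (auto simp: le_def extend_core_def)
  have lev: "snd u < snd v" if "le u v" "u \<noteq> v" for u v
    using extend_core_level[OF E] that by (auto simp: le_def)
  have "a \<noteq> x" "d \<noteq> w" using le inc by auto
  then have ax: "snd a < snd x" and dw: "snd d < snd w" using lev le by auto
  \<comment> \<open>An element at level \<open>c\<close> or above is comparable with every element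
    of another level in the first \<open>R\<close> rows. If \<open>w\<close> or \<open>x\<close>
    were that high, they would share a level, and \<open>d\<close>, being below \<open>w\<close>,
    would be below \<open>x\<close> too.\<close>
  have wx: "snd w = snd x" if "c \<le> snd w \<or> c \<le> snd x"
    using that high[of w x] high[of x w] inc rows by linarith
  have "snd w < c \<and> snd x < c"
    using wx high[of d x] dw inc rows by force
  then show ?thesis using rows ax dw by (auto simp: mem_Times_iff)
qed

lemma extend_core_base:
  assumes "x \<in> {..<R} \<times> {..<c}" "y \<in> {..<R} \<times> {..<c}"
  shows "(x, y) \<in> extend_core R c E \<longleftrightarrow> x = y \<or> (x, y) \<in> E"
  using assms by (auto simp: extend_core_def)

text \<open>Permutations of this kind act within the levels of the first \<open>R\<close> rows and
  fix the chain rows, so they preserve every relation of \<open>extend_core\<close> that does not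
  come from the core.\<close>

definition core_perm :: "nat \<Rightarrow> (nat \<times> nat \<Rightarrow> nat \<times> nat) \<Rightarrow> bool" where
  "core_perm R p \<longleftrightarrow>
     (\<forall>x. snd (p x) = snd x \<and> (fst (p x) < R \<longleftrightarrow> fst x < R) \<and> (R \<le> fst x \<longrightarrow> p x = x))"

text \<open>A matching found on the finite core carries over to the extension, because the added
  relations are the same for \<open>E\<close> and \<open>F\<close> and are invariant under
  \<open>p\<close>.\<close>

lemma rel_mono_extend_core:
  assumes E: "layered_core R c E" and F: "layered_core R c F"
    and pA: "p permutes A" and p: "core_perm R p"
    and core: "(rel_mono (E \<inter> A \<times> A) (\<sigma> \<circ> p) \<and> C) \<longleftrightarrow> (rel_mono (F \<inter> A \<times> A) \<sigma> \<and> D)"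
  shows "rel_mono (extend_core R c E \<inter> A \<times> A) (\<sigma> \<circ> p) \<and> C \<longleftrightarrow>
         rel_mono (extend_core R c F \<inter> A \<times> A) \<sigma> \<and> D"
proof -
  \<comment> \<open>The empty core leaves exactly the common relations: reflexive pairs, stacked
    levels and chain rows.\<close>
  define O' where "O' = extend_core R c {}"
  have split: "extend_core R c E = E \<union> O'" if "layered_core R c E" for E
    using layered_coreD(2)[OF that] by (auto simp: extend_core_def O'_def)
  have mono_Un: "rel_mono ((E \<union> O') \<inter> A \<times> A) \<tau>
      \<longleftrightarrow> rel_mono (E \<inter> A \<times> A) \<tau> \<and> rel_mono (O' \<inter> A \<times> A) \<tau>" for E \<tau>
    by (auto simp: rel_mono_def)
  have pO: "(p x, p y) \<in> O' \<longleftrightarrow> (x, y) \<in> O'" for x y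
  proof -
    have "p x = p y \<longleftrightarrow> x = y" using permutes_inj[OF pA] by (simp add: inj_eq)
    moreover have snd: "snd (p z) = snd z" and row: "fst (p z) < R \<longleftrightarrow> fst z < R" for z
      using p unfolding core_perm_def by blast+
    moreover have "fst (p x) = fst (p y) \<longleftrightarrow> fst x = fst y" if "\<not> (fst x < R \<and> fst y < R)"
      using p that row unfolding core_perm_def by (metis leI)
    ultimately show ?thesis
      unfolding O'_def extend_core_def by (simp only: mem_Collect_eq prod.case empty_iff snd row) auto
  qed
  have "rel_mono (O' \<inter> A \<times> A) (\<sigma> \<circ> p) \<longleftrightarrow> rel_mono (O' \<inter> A \<times> A) \<sigma>"
  proof
    assume L: "rel_mono (O' \<inter> A \<times> A) (\<sigma> \<circ> p)"
    show "rel_mono (O' \<inter> A \<times> A) \<sigma>"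
      unfolding rel_mono_def
    proof safe
      fix a b a' b' assume *: "((a, b), (a', b')) \<in> O'" "(a, b) \<in> A" "(a', b') \<in> A"
      then obtain x y where "(a, b) = p x" "(a', b') = p y" "x \<in> A" "y \<in> A"
        using permutes_image[OF pA] by (metis imageE)
      then show "\<sigma> (a, b) \<le> \<sigma> (a', b')"
        using L * pO by (auto simp: rel_mono_def)
    qed
  next
    assume L: "rel_mono (O' \<inter> A \<times> A) \<sigma>"
    show "rel_mono (O' \<inter> A \<times> A) (\<sigma> \<circ> p)"
      unfolding rel_mono_def
    proof (intro ballI, clarify)
      fix a b a' b' assume *: "((a, b), (a', b')) \<in> O'" "(a, b) \<in> A" "(a', b') \<in> A"
      then have "(p (a, b), p (a', b')) \<in> O' \<inter> A \<times> A"
        using pO permutes_in_image[OF pA] by auto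
      from bspec[OF L[unfolded rel_mono_def] this]
      show "(\<sigma> \<circ> p) (a, b) \<le> (\<sigma> \<circ> p) (a', b')" by simp
    qed
  qed
  then show ?thesis unfolding split[OF E] split[OF F] mono_Un using core by blast
qed

text \<open>Reduces the theorem to data on a core pair. \<open>h\<close> sends levels to columns of
  the diagram; \<open>C\<close> and \<open>D\<close> are the splitting conditions, \<open>p\<close>
  matches the halves where they hold and \<open>q\<close> the halves where they fail.\<close>

lemma pair_of_shape:
  assumes lam: "is_partition lam"
    and E: "layered_core R c E" and F: "layered_core R c F"
    and h: "bij h" and A: "A = {(i, l). (i, h l) \<in> young_diagram lam}"
    and p: "p permutes A" "core_perm R p" and q: "q permutes A" "core_perm R q"
    and C: "\<And>\<sigma>. rel_mono (E \<inter> A \<times> A) (\<sigma> \<circ> p) \<and> C (\<sigma> \<circ> p) \<longleftrightarrow> rel_mono (F \<inter> A \<times> A) \<sigma> \<and> D \<sigma>"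
    and nC: "\<And>\<sigma>. rel_mono (E \<inter> A \<times> A) (\<sigma> \<circ> q) \<and> \<not> C (\<sigma> \<circ> q) \<longleftrightarrow> rel_mono (F \<inter> A \<times> A) \<sigma> \<and> \<not> D \<sigma>"
    and noniso: "\<not> poset_isomorphic A (extend_core R c E \<inter> A \<times> A) A (extend_core R c F \<inter> A \<times> A)"
  shows "\<exists>(n::nat) (P::nat rel) (m::nat) (Q::nat rel).
           naturally_labeled_poset n P \<and> naturally_labeled_poset m Q \<and>
           \<not> poset_isomorphic {1..n} P {1..m} Q \<and>
           has_shape {1..n} P lam \<and> has_shape {1..m} Q lam \<and>
           P_partition_gf {1..n} P = P_partition_gf {1..m} Q"
proof -
  let ?P = "extend_core R c E \<inter> A \<times> A" and ?Q = "extend_core R c F \<inter> A \<times> A"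
  let ?n = "card A"
  have g: "bij_betw (map_prod id h) A (young_diagram lam)"
  proof -
    have "A = map_prod id h -` young_diagram lam" by (auto simp: A)
    moreover have "bij (map_prod id h)"
      using h by (intro bij_betw_map_prod[of id UNIV UNIV h UNIV UNIV, simplified]) auto
    ultimately show ?thesis
      by (metis bij_betw_def bij_is_inj bij_is_surj inj_on_subset subset_UNIV surj_image_vimage_eq)
  qed
  have fin: "finite A" using g finite_young_diagram bij_betw_finite by blast
  have shape: "has_shape B s lam"
    if E: "layered_core R c E" and iso: "poset_isomorphic A (extend_core R c E \<inter> A \<times> A) B s"
    for E and B :: "nat set" and s
  proof (rule has_shape_isomorphic_young_bij[OF poset_isomorphic_sym[OF iso] lam g])
    fix x y assume xy: "x \<in> A" "y \<in> A"
    show "(x, y) \<in> extend_core R c E \<inter> A \<times> A \<or> (y, x) \<in> extend_core R c E \<inter> A \<times> A"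
      if "fst (map_prod id h x) = fst (map_prod id h y)"
      using extend_core_row[OF E, of x y] that xy by (auto simp: fst_map_prod)
    show "x = y" if "snd (map_prod id h x) = snd (map_prod id h y)"
      "(x, y) \<in> extend_core R c E \<inter> A \<times> A"
    proof (rule ccontr)
      assume "x \<noteq> y"
      then have "snd x < snd y" using extend_core_level[OF E] that by blast
      then show False using that h by (auto simp: snd_map_prod bij_def inj_eq)
    qed
  qed
  have gf: "P_partition_gf A ?P = P_partition_gf A ?Q"
    using rel_mono_extend_core[OF E F p C] rel_mono_extend_core[OF E F q nC]
    by (intro P_partition_gf_eqI[OF fin p(1) q(1), of _ C _ D])
  obtain P where P: "naturally_labeled_poset ?n P" "poset_isomorphic A ?P {1..?n} P"
    using ex_natural_labeling[OF fin partial_order_extend_core[OF E]] by blast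
  obtain Q where Q: "naturally_labeled_poset ?n Q" "poset_isomorphic A ?Q {1..?n} Q"
    using ex_natural_labeling[OF fin partial_order_extend_core[OF F]] by blast
  have "P \<subseteq> {1..?n} \<times> {1..?n}" "Q \<subseteq> {1..?n} \<times> {1..?n}"
    using P(1) Q(1) by (simp_all add: naturally_labeled_poset_def partial_order_on_def preorder_on_def)
  then have "P_partition_gf {1..?n} P = P_partition_gf {1..?n} Q"
    using P_partition_gf_isomorphic[OF P(2)] P_partition_gf_isomorphic[OF Q(2)] gf by simp
  moreover have "\<not> poset_isomorphic {1..?n} P {1..?n} Q"
    using noniso P(2) poset_isomorphic_sym[OF Q(2)] poset_isomorphic_trans by metis
  ultimately show ?thesis
    using P(1) Q(1) shape[OF E P(2)] shape[OF F Q(2)] by blast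
qed

section \<open>A core with three levels\<close>

text \<open>
  Depending on which of the elements (2,0) and (2,2) are present, this core has shape (3,3,1),
  (3,3,2) or (3,3,3).  The level that is always full is the middle one, so it is matched with the
  first column of the Young diagram.
\<close>

definition tri :: "nat \<Rightarrow> (nat \<times> nat) rel" where
  "tri k = {((i, l), (i', l')). i < 3 \<and> i' < 3 \<and>
     (l = 0 \<and> l' = 1 \<and> (i = 2 \<or> (i = 1 \<longleftrightarrow> i' = 1)) \<or>
      l = 1 \<and> l' = 2 \<and> (i' = 2 \<or> (i = k \<longleftrightarrow> i' = k)) \<or>
      l = 0 \<and> l' = 2)}"

text \<open>Transitivity holds because a composite runs from level 0 to level 2, where all pairs are
  related. From below, the middle level is split into row 1 against rows 0 and 2; from above, into
  row \<open>k\<close> against the rest. Only (2,0) and (2,2) are related to all of it.\<close>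

lemma layered_core_tri: "layered_core 3 3 (tri k)"
proof -
  have "((i, l), (i, l')) \<in> tri k" if "i < 3" "l < l'" "l' < 3" for i l l' :: nat
  proof -
    have "l = 0 \<and> l' = 1 \<or> l = 1 \<and> l' = 2 \<or> l = 0 \<and> l' = 2" using that by linarith
    then show ?thesis using that by (auto simp: tri_def)
  qed
  moreover have "trans (tri k)" by (rule transI) (auto simp: tri_def)
  ultimately show ?thesis by (auto simp: layered_core_def tri_def)
qed

text \<open>The guards by membership in \<open>A\<close> let one computation serve all three core
  shapes, in which (2,0) and (2,2) may be absent.\<close>

lemma rel_mono_tri:
  "rel_mono (tri k \<inter> A \<times> A) \<sigma> \<longleftrightarrow>
    (\<forall>i<3. \<forall>j<3.
      ((i, 0) \<in> A \<longrightarrow> (j, 1) \<in> A \<longrightarrow> i = 2 \<or> (i = 1 \<longleftrightarrow> j = 1) \<longrightarrow> \<sigma> (i, 0) \<le> \<sigma> (j, 1)) \<and>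
      ((i, 1) \<in> A \<longrightarrow> (j, 2) \<in> A \<longrightarrow> j = 2 \<or> (i = k \<longleftrightarrow> j = k) \<longrightarrow> \<sigma> (i, 1) \<le> \<sigma> (j, 2)) \<and>
      ((i, 0) \<in> A \<longrightarrow> (j, 2) \<in> A \<longrightarrow> \<sigma> (i, 0) \<le> \<sigma> (j, 2)))"
  (is "?L \<longleftrightarrow> ?R")
proof
  assume ?L
  then have "\<sigma> x \<le> \<sigma> y" if "(x, y) \<in> tri k" "x \<in> A" "y \<in> A" for x y
    using that by (auto simp: rel_mono_def)
  then show ?R by (simp add: tri_def)
next
  assume R: ?R
  show ?L
    unfolding rel_mono_def
  proof clarify
    fix i l j m assume "((i, l), (j, m)) \<in> tri k" "(i, l) \<in> A" "(j, m) \<in> A"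
    then show "\<sigma> (i, l) \<le> \<sigma> (j, m)"
      using R[rule_format, of i j] by (auto simp: tri_def)
  qed
qed

text \<open>In \<open>tri 1\<close> the two splits of the middle level coincide, so the middle
  elements of rows 0 and 2 are twins. The pattern, a chain \<open>a\<close>, \<open>b\<close>,
  \<open>w\<close> with \<open>d\<close> under \<open>w\<close> and \<open>x\<close> over
  \<open>a\<close>, would need two different splits.\<close>

lemma tri_avoids:
  assumes le_def: "le = (\<lambda>x y. (x, y) \<in> extend_core 3 3 (tri 1))"
    and le: "le a b" "le b w" "le d w" "le a x"
    and inc: "\<not> le d a" "\<not> le a d" "\<not> le d b" "\<not> le b d" "\<not> le d x" "\<not> le x d"
      "\<not> le b x" "\<not> le x b" "\<not> le w x" "\<not> le x w"
  shows False
proof -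
  note E = layered_core_tri[of 1]
  have aw: "le a w"
    using transD[OF trans_extend_core[OF E], of a b w] le(1,2) by (simp add: le_def)
  have in_core: "{d, w, a, x} \<subseteq> {..<3} \<times> {..<3}"
    by (rule zigzag_in_core[OF E le_def]) (fact le aw inc)+
  have "b \<in> {..<3} \<times> {..<3}"
  proof -
    have "snd b \<le> snd w"
      using extend_core_level[OF E, of b w] le(2) by (cases "b = w") (simp_all add: le_def)
    then show ?thesis
      using le(2) in_core by (auto simp: le_def extend_core_def mem_Times_iff split: if_splits)
  qed
  with in_core have mem: "{a, b, w, d, x} \<subseteq> {..<3} \<times> {..<3}" by auto
  have base: "le u v \<longleftrightarrow> u = v \<or> (u, v) \<in> tri 1" if "{u, v} \<subseteq> {a, b, w, d, x}" for u v
    unfolding le_def using that mem by (intro extend_core_base) auto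
  have ab: "(a, b) \<in> tri 1" and bw: "(b, w) \<in> tri 1" and dw: "(d, w) \<in> tri 1"
    and ax: "(a, x) \<in> tri 1"
    using base le inc by auto
  have not: "(d, x) \<notin> tri 1" "(d, b) \<notin> tri 1" "(a, d) \<notin> tri 1" "(b, x) \<notin> tri 1"
    "(x, w) \<notin> tri 1"
    using base inc by auto
  obtain i j k where a: "a = (i, 0)" and b: "b = (j, 1)" and w: "w = (k, 2)"
    using ab bw by (auto simp: tri_def)
  obtain i' l' where d: "d = (i', l')" by (cases d)
  obtain j' m' where x: "x = (j', m')" by (cases x)
  have "l' = 0 \<or> l' = 1" "m' = 1 \<or> m' = 2"
    using dw ax by (auto simp: tri_def a w d x)
  \<comment> \<open>The first case fails because levels 0 and 2 are fully related. If
    \<open>x\<close> is in the middle, \<open>b\<close> and \<open>x\<close> are forced into one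
    class although \<open>w\<close> is above \<open>b\<close> only. Otherwise \<open>a\<close> puts
    \<open>b\<close> and \<open>d\<close> into different classes, and \<open>x\<close> at level 2 is
    above at least one of them.\<close>
  then consider "l' = 0" "m' = 2" | "l' = 0" "m' = 1" | "l' = 1" "m' = 1" | "l' = 1" "m' = 2"
    by blast
  then show False
  proof cases
    case 1
    then show ?thesis using ab bw dw ax not by (auto simp: tri_def a b w d x)
  next
    case 2
    then show ?thesis using ab bw dw ax not by (auto simp: tri_def a b w d x)
  next
    case 3
    then show ?thesis using ab bw dw ax not by (auto simp: tri_def a b w d x)
  next
    case 4
    then show ?thesis using ab bw dw ax not by (auto simp: tri_def a b w d x)
  qed
qed

section \<open>A core with two levels\<close>

definition bip :: "nat rel \<Rightarrow> (nat \<times> nat) rel" where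
  "bip S = {((i, l), (i', l')). l = 0 \<and> l' = 1 \<and> (i, i') \<in> S}"

text \<open>Pairs are (lower row, upper row). Up to relabeling, \<open>S0\<close> and
  \<open>S1\<close> differ in a single pair.\<close>

definition S0 :: "nat rel" where
  "S0 = {(0,0), (0,1), (0,3), (1,0), (1,1), (1,2), (2,1), (2,2), (3,0), (3,3)}"

definition S1 :: "nat rel" where
  "S1 = {(0,0), (0,2), (0,3), (1,0), (1,1), (1,3), (2,1), (2,2), (3,0), (3,3)}"

lemma layered_core_bip:
  assumes "\<And>i. i < R \<Longrightarrow> (i, i) \<in> S" "S \<subseteq> {..<R} \<times> {..<R}"
  shows "layered_core R 2 (bip S)"
proof -
  have "trans (bip S)" by (rule transI) (auto simp: bip_def)
  moreover have "l = 0 \<and> l' = 1" if "l < l'" "l' < 2" for l l' :: nat using that by linarith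
  ultimately show ?thesis using assms by (force simp: layered_core_def bip_def)
qed

lemma layered_core_S0: "layered_core 4 2 (bip S0)"
proof (rule layered_core_bip)
  have "{..<4} = {0, 1, 2, 3::nat}" by auto
  then show "(i, i) \<in> S0" if "i < 4" for i
    using that lessThan_iff[of i 4] by (auto simp: S0_def)
qed (simp add: S0_def)

lemma layered_core_S1: "layered_core 4 2 (bip S1)"
proof (rule layered_core_bip)
  have "{..<4} = {0, 1, 2, 3::nat}" by auto
  then show "(i, i) \<in> S1" if "i < 4" for i
    using that lessThan_iff[of i 4] by (auto simp: S1_def)
qed (simp add: S1_def)

lemma mem_S1_iff:
  "(i, m) \<in> S1 \<longleftrightarrow> (m = 0 \<or> m = 3) \<and> (i = 0 \<or> i = 1 \<or> i = 3) \<or>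
     m = 1 \<and> (i = 1 \<or> i = 2) \<or> m = 2 \<and> (i = 0 \<or> i = 2)"
  by (auto simp: S1_def)

text \<open>In \<open>S1\<close> only the upper elements 0 and 3 have two common lower elements, and
  these two have exactly the same lower elements 0, 1, 3. Hence no \<open>x\<close> can lie below
  \<open>d\<close> but not below \<open>w\<close>.\<close>

lemma bip_avoids:
  assumes le_def: "le = (\<lambda>x y. (x, y) \<in> extend_core 4 2 (bip S1))"
    and le: "le a w" "le a d" "le b w" "le b d" "le x d"
    and inc: "\<not> le x a" "\<not> le a x" "\<not> le x b" "\<not> le b x" "\<not> le a b" "\<not> le b a"
      "\<not> le x w" "\<not> le w x" "\<not> le w d" "\<not> le d w"
  shows False
proof -
  note E = layered_core_S1
  \<comment> \<open>Two zigzags, one through \<open>a\<close> and one through \<open>b\<close>,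
    together cover the five elements.\<close>
  have "{x, d, a, w} \<subseteq> {..<4} \<times> {..<2}" "{x, d, b, w} \<subseteq> {..<4} \<times> {..<2}"
    by (rule zigzag_in_core[OF E le_def]; fact le inc)+
  then have base: "le u v \<longleftrightarrow> u = v \<or> (u, v) \<in> bip S1" if "{u, v} \<subseteq> {a, b, w, d, x}" for u v
    unfolding le_def using that by (intro extend_core_base) auto
  have E: "(a, w) \<in> bip S1" "(a, d) \<in> bip S1" "(b, w) \<in> bip S1" "(b, d) \<in> bip S1"
    "(x, d) \<in> bip S1" "(x, w) \<notin> bip S1" "a \<noteq> b" "w \<noteq> d"
    using base le inc by auto
  obtain i j k m n where eqs: "a = (i, 0)" "b = (j, 0)" "x = (k, 0)" "w = (m, 1)" "d = (n, 1)"
    using E(1-5) by (auto simp: bip_def)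
  have rows: "(i, m) \<in> S1" "(i, n) \<in> S1" "(j, m) \<in> S1" "(j, n) \<in> S1" "(k, n) \<in> S1"
      "(k, m) \<notin> S1" "i \<noteq> j" "m \<noteq> n"
    using E unfolding eqs by (simp_all add: bip_def)
  have "m \<in> {0, 1, 2, 3}" "n \<in> {0, 1, 2, 3}"
    using rows(1,2) unfolding mem_S1_iff by blast+
  then show False
    using rows unfolding mem_S1_iff
    by (elim insertE emptyE; simp only: simp_thms zero_neq_one; auto)
qed

section \<open>Non-isomorphism of the extended cores\<close>

lemma poset_isomorphicE:
  assumes "poset_isomorphic A (r \<inter> A \<times> A) A (s \<inter> A \<times> A)"
  obtains f where "\<And>x y. x \<in> A \<Longrightarrow> y \<in> A \<Longrightarrow> (f x, f y) \<in> s \<longleftrightarrow> (x, y) \<in> r"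
proof -
  obtain f where f: "bij_betw f A A"
    "\<forall>x\<in>A. \<forall>y\<in>A. (x, y) \<in> r \<inter> A \<times> A \<longleftrightarrow> (f x, f y) \<in> s \<inter> A \<times> A"
    using assms unfolding poset_isomorphic_def by blast
  then have "f x \<in> A" if "x \<in> A" for x using that by (auto simp: bij_betw_def)
  with f(2) show ?thesis by (intro that[of f]) blast
qed

text \<open>In \<open>tri 0\<close> the two splits of the middle level differ: (0,2) is above (0,1)
  but not above (2,1), so the five elements realise the pattern of
  \<open>tri_avoids\<close>.\<close>

lemma not_isomorphic_tri:
  assumes A: "{(0, 0), (1, 0), (0, 1), (2, 1), (0, 2)} \<subseteq> A"
  shows "\<not> poset_isomorphic A (extend_core 3 3 (tri 0) \<inter> A \<times> A)
           A (extend_core 3 3 (tri 1) \<inter> A \<times> A)"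
proof
  assume "poset_isomorphic A (extend_core 3 3 (tri 0) \<inter> A \<times> A)
           A (extend_core 3 3 (tri 1) \<inter> A \<times> A)"
  then obtain f where f: "\<And>x y. x \<in> A \<Longrightarrow> y \<in> A \<Longrightarrow>
      (f x, f y) \<in> extend_core 3 3 (tri 1) \<longleftrightarrow> (x, y) \<in> extend_core 3 3 (tri 0)"
    by (rule poset_isomorphicE) blast
  have m: "(0, 0) \<in> A" "(1, 0) \<in> A" "(0, 1) \<in> A" "(2, 1) \<in> A" "(0, 2) \<in> A"
    using A by simp_all
  show False
    by (rule tri_avoids[OF refl, of "f (0, 0)" "f (0, 1)" "f (0, 2)" "f (1, 0)" "f (2, 1)"])
       (simp_all only: f m, simp_all add: extend_core_def tri_def)
qed

text \<open>In \<open>S0\<close> the lower elements 0 and 1 are under both upper elements 0 and 1,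
  while the lower element 2 is under 1 but not under 0: the pattern of
  \<open>bip_avoids\<close>.\<close>

lemma not_isomorphic_bip:
  assumes A: "{(0, 0), (1, 0), (2, 0), (0, 1), (1, 1)} \<subseteq> A"
  shows "\<not> poset_isomorphic A (extend_core 4 2 (bip S0) \<inter> A \<times> A)
           A (extend_core 4 2 (bip S1) \<inter> A \<times> A)"
proof
  assume "poset_isomorphic A (extend_core 4 2 (bip S0) \<inter> A \<times> A)
           A (extend_core 4 2 (bip S1) \<inter> A \<times> A)"
  then obtain f where f: "\<And>x y. x \<in> A \<Longrightarrow> y \<in> A \<Longrightarrow>
      (f x, f y) \<in> extend_core 4 2 (bip S1) \<longleftrightarrow> (x, y) \<in> extend_core 4 2 (bip S0)"
    by (rule poset_isomorphicE) blast
  have m: "(0, 0) \<in> A" "(1, 0) \<in> A" "(2, 0) \<in> A" "(0, 1) \<in> A" "(1, 1) \<in> A"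
    using A by simp_all
  show False
    by (rule bip_avoids[OF refl, of "f (0, 0)" "f (0, 1)" "f (1, 1)" "f (1, 0)" "f (2, 0)"])
       (simp_all only: f m, simp_all add: extend_core_def bip_def S0_def)
qed

section \<open>The two families of shapes, with explicit matchings of the halves\<close>

theorem theorem5p5:
  fixes lam :: "nat list"
  assumes "is_partition lam"
    and "young_diagram [3, 3, 1] \<subseteq> young_diagram lam \<or>
         young_diagram [2, 2, 2, 2] \<subseteq> young_diagram lam"
  shows "\<exists>(n::nat) (P::nat rel) (m::nat) (Q::nat rel).
           naturally_labeled_poset n P \<and> naturally_labeled_poset m Q \<and>
           \<not> poset_isomorphic {1..n} P {1..m} Q \<and>
           has_shape {1..n} P lam \<and> has_shape {1..m} Q lam \<and>
           P_partition_gf {1..n} P = P_partition_gf {1..m} Q"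
  using assms(2)
proof
  assume sub: "young_diagram [3, 3, 1] \<subseteq> young_diagram lam"
  define h :: "nat \<Rightarrow> nat" where "h = transpose 0 1"
  define A where "A = {(i, l). (i, h l) \<in> young_diagram lam}"
  have "{(0,0), (0,1), (0,2), (1,0), (1,1), (1,2), (2,0)} \<subseteq> young_diagram [3, 3, 1]"
    by (simp add: young_diagram_def)
  then have "{(0,0), (0,1), (0,2), (1,0), (1,1), (1,2), (2,0)} \<subseteq> young_diagram lam"
    using sub by (rule subset_trans)
  then have A: "(0,0) \<in> A" "(0,1) \<in> A" "(0,2) \<in> A" "(1,0) \<in> A" "(1,1) \<in> A" "(1,2) \<in> A" "(2,1) \<in> A"
    by (simp_all add: A_def h_def transpose_def)
  \<comment> \<open>\<open>p\<close> swaps rows 0 and 1 on the outer levels and rotates the middle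
    one. It turns \<open>tri 0\<close> with the extra inequality from (1,0) to (2,1) exactly into
    \<open>tri 1\<close> with the one from (1,0) to (0,1).\<close>
  define p :: "nat \<times> nat \<Rightarrow> nat \<times> nat" where
    "p = transpose (0,0) (1,0) \<circ> (transpose (0,2) (1,2) \<circ> (transpose (0,1) (1,1) \<circ> transpose (1,1) (2,1)))"
  \<comment> \<open>After this swap the orders differ only in whether (0,1) is bounded by (0,2) or
    by (1,2). In the half where (0,1) has a smaller value than (1,0), both bounds are automatic,
    since (1,0) is below all of level 2.\<close>
  define q :: "nat \<times> nat \<Rightarrow> nat \<times> nat" where "q = transpose (0,1) (2,1)"
  have all3: "(\<forall>i<3. P i) \<longleftrightarrow> P 0 \<and> P 1 \<and> P 2" for P :: "nat \<Rightarrow> bool"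
    by (auto simp: numeral_eq_Suc less_Suc_eq)
  show ?thesis
  proof (rule pair_of_shape[OF assms(1) layered_core_tri[of 0] layered_core_tri[of 1] _ A_def, of p q])
    show "bij h" by (simp add: h_def)
    show "p permutes A" "q permutes A"
      unfolding p_def q_def using A by (intro permutes_compose permutes_swap_id; simp)+
    show "core_perm 3 p" "core_perm 3 q"
      by (auto simp: core_perm_def p_def q_def transpose_def)
    show "rel_mono (tri 0 \<inter> A \<times> A) (\<sigma> \<circ> p) \<and> (\<sigma> \<circ> p) (1, 0) \<le> (\<sigma> \<circ> p) (2, 1) \<longleftrightarrow>
        rel_mono (tri 1 \<inter> A \<times> A) \<sigma> \<and> \<sigma> (1, 0) \<le> \<sigma> (0, 1)" for \<sigma>
      unfolding rel_mono_tri all3 using A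
      by (simp add: p_def transpose_def del: One_nat_def)
         (rule iffI; elim conjE; intro conjI impI; simp only: simp_thms; linarith?)
    show "rel_mono (tri 0 \<inter> A \<times> A) (\<sigma> \<circ> q) \<and> \<not> (\<sigma> \<circ> q) (1, 0) \<le> (\<sigma> \<circ> q) (2, 1) \<longleftrightarrow>
        rel_mono (tri 1 \<inter> A \<times> A) \<sigma> \<and> \<not> \<sigma> (1, 0) \<le> \<sigma> (0, 1)" for \<sigma>
      unfolding rel_mono_tri all3 using A
      by (simp add: q_def transpose_def del: One_nat_def)
         (rule iffI; elim conjE; intro conjI impI; simp only: simp_thms; linarith?)
    show "\<not> poset_isomorphic A (extend_core 3 3 (tri 0) \<inter> A \<times> A)
        A (extend_core 3 3 (tri 1) \<inter> A \<times> A)"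
      using A by (intro not_isomorphic_tri) simp
  qed
next
  assume sub: "young_diagram [2, 2, 2, 2] \<subseteq> young_diagram lam"
  define A where "A = {(i, l). (i, id l) \<in> young_diagram lam}"
  have "{(0,0), (0,1), (1,0), (1,1), (2,0), (2,1), (3,0), (3,1)} \<subseteq> young_diagram [2, 2, 2, 2]"
    by (simp add: young_diagram_def)
  then have "{(0,0), (0,1), (1,0), (1,1), (2,0), (2,1), (3,0), (3,1)} \<subseteq> young_diagram lam"
    using sub by (rule subset_trans)
  then have A: "(0,0) \<in> A" "(0,1) \<in> A" "(1,0) \<in> A" "(1,1) \<in> A"
      "(2,0) \<in> A" "(2,1) \<in> A" "(3,0) \<in> A" "(3,1) \<in> A"
    by (simp_all add: A_def)
  \<comment> \<open>After \<open>p\<close>, \<open>S0\<close> has the pair (0,1) where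
    \<open>S1\<close> has (0,3). Both inequalities follow from \<sigma>(0,0) \<le> \<sigma>(1,0),
    since the lower element 1 is under the upper elements 1 and 3.\<close>
  define p :: "nat \<times> nat \<Rightarrow> nat \<times> nat" where
    "p = transpose (2,0) (3,0) \<circ> (transpose (0,1) (1,1) \<circ> transpose (2,1) (3,1))"
  \<comment> \<open>After \<open>q\<close>, the pair (1,2) stands where \<open>S1\<close> has (1,3).
    Both follow when (1,0) has a smaller value than (0,0), since the lower element 0 is under the
    upper elements 2 and 3.\<close>
  define q :: "nat \<times> nat \<Rightarrow> nat \<times> nat" where "q = transpose (1,1) (2,1)"
  have rel_mono_bip: "rel_mono (bip S \<inter> A \<times> A) \<sigma> \<longleftrightarrow>
      (\<forall>(i, j)\<in>S. (i, 0) \<in> A \<longrightarrow> (j, 1) \<in> A \<longrightarrow> \<sigma> (i, 0) \<le> \<sigma> (j, 1))" for S \<sigma>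
    by (auto simp: rel_mono_def bip_def)
  show ?thesis
  proof (rule pair_of_shape[OF assms(1) layered_core_S0 layered_core_S1 _ A_def, of p q])
    show "bij id" by simp
    show "p permutes A" "q permutes A"
      unfolding p_def q_def using A by (intro permutes_compose permutes_swap_id; simp)+
    show "core_perm 4 p" "core_perm 4 q"
      by (auto simp: core_perm_def p_def q_def transpose_def)
    show "rel_mono (bip S0 \<inter> A \<times> A) (\<sigma> \<circ> p) \<and> (\<sigma> \<circ> p) (0, 0) \<le> (\<sigma> \<circ> p) (1, 0) \<longleftrightarrow>
        rel_mono (bip S1 \<inter> A \<times> A) \<sigma> \<and> \<sigma> (0, 0) \<le> \<sigma> (1, 0)" for \<sigma>
      unfolding rel_mono_bip S0_def S1_def using A
      by (simp add: p_def transpose_def del: One_nat_def)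
         (rule iffI; elim conjE; intro conjI impI; simp only: simp_thms; linarith?)
    show "rel_mono (bip S0 \<inter> A \<times> A) (\<sigma> \<circ> q) \<and> \<not> (\<sigma> \<circ> q) (0, 0) \<le> (\<sigma> \<circ> q) (1, 0) \<longleftrightarrow>
        rel_mono (bip S1 \<inter> A \<times> A) \<sigma> \<and> \<not> \<sigma> (0, 0) \<le> \<sigma> (1, 0)" for \<sigma>
      unfolding rel_mono_bip S0_def S1_def using A
      by (simp add: q_def transpose_def del: One_nat_def)
         (rule iffI; elim conjE; intro conjI impI; simp only: simp_thms; linarith?)
    show "\<not> poset_isomorphic A (extend_core 4 2 (bip S0) \<inter> A \<times> A)
        A (extend_core 4 2 (bip S1) \<inter> A \<times> A)"
      using A by (intro not_isomorphic_bip) simp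
  qed
qed

end
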